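(* Let $r,s,t$ be integers with $1\leq r\leq s\leq t$ and $r\geq 5$. Then the graph $\Delta_{r,s,t}$ has no interval coloring, i.e. $\Delta_{r,s,t}\notin \mathfrak{N}$.
   Context: All graphs are finite, without loops or multiple edges. For a graph $G$ and a proper edge-coloring $\alpha$, $S(v,\alpha)$ denotes the set of colors of edges incident to $v$. An interval $t$-coloring of $G$ is a proper edge-coloring of $G$ with colors $1,\ldots,t$ such that every color is used and for every vertex $v$ the set $S(v,\alpha)$ is an interval of integers. $\mathfrak{N}$ denotes the set of graphs having an interval $t$-coloring for some positive integer $t$. For $1\leq r\leq s\leq t$, the graph $\Delta_{r,s,t}$ has vertex set $\{v,x,y,z\}\cup\{a_1,\ldots,a_r,b_1,\ldots,b_s,c_1,\ldots,c_t\}$ and edge set $\{va_i,xa_i,ya_i:1\leq i\leq r\}\cup\{vb_j,xb_j,zb_j:1\leq j\leq s\}\cup\{vc_k,yc_k,zc_k:1\leq k\leq t\}$. It is a connected bipartite graph with maximum degree $r+s+t$. *)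

theory Defs
  imports Main
begin

record 'a ugraph =
  verts :: "'a set"
  edges :: "'a set set"

definition simple_graph :: "'a ugraph \<Rightarrow> bool" where
  "simple_graph G \<longleftrightarrow>
     finite (verts G) \<and> (\<forall>e\<in>edges G. e \<subseteq> verts G \<and> card e = 2)"

definition proper_edge_coloring :: "'a ugraph \<Rightarrow> ('a set \<Rightarrow> nat) \<Rightarrow> bool" where
  "proper_edge_coloring G \<alpha> \<longleftrightarrow>
     (\<forall>e\<in>edges G. \<forall>f\<in>edges G. e \<noteq> f \<and> e \<inter> f \<noteq> {} \<longrightarrow> \<alpha> e \<noteq> \<alpha> f)"

definition spectrum :: "'a ugraph \<Rightarrow> 'a \<Rightarrow> ('a set \<Rightarrow> nat) \<Rightarrow> nat set" where
  "spectrum G v \<alpha> = \<alpha> ` {e \<in> edges G. v \<in> e}"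

text \<open>The set of colors at an isolated vertex is empty, which counts as an interval
  (\<open>{m..n}\<close> with \<open>n < m\<close>).\<close>

definition interval_coloring :: "'a ugraph \<Rightarrow> nat \<Rightarrow> ('a set \<Rightarrow> nat) \<Rightarrow> bool" where
  "interval_coloring G t \<alpha> \<longleftrightarrow>
     proper_edge_coloring G \<alpha> \<and> \<alpha> ` edges G = {1..t} \<and>
     (\<forall>v\<in>verts G. \<exists>m n. spectrum G v \<alpha> = {m..n})"

definition interval_colorable :: "'a ugraph set" ("\<NN>") where
  "\<NN> = {G. simple_graph G \<and> (\<exists>t\<ge>1. \<exists>\<alpha>. interval_coloring G t \<alpha>)}"

datatype delta_vertex = V | X | Y | Z | A nat | B nat | C nat

definition Delta :: "nat \<Rightarrow> nat \<Rightarrow> nat \<Rightarrow> delta_vertex ugraph" where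
  "Delta r s t =
     \<lparr> verts = {V, X, Y, Z} \<union> A ` {1..r} \<union> B ` {1..s} \<union> C ` {1..t},
       edges = (\<Union>i\<in>{1..r}. {{V, A i}, {X, A i}, {Y, A i}})
             \<union> (\<Union>j\<in>{1..s}. {{V, B j}, {X, B j}, {Z, B j}})
             \<union> (\<Union>k\<in>{1..t}. {{V, C k}, {Y, C k}, {Z, C k}}) \<rparr>"

text \<open>Hence non-membership of \<open>Delta r s t\<close> in \<open>\<NN>\<close> is never due to the conjunct
  \<open>simple_graph\<close>.\<close>

lemma simple_graph_Delta: "simple_graph (Delta r s t)"
  by (auto simp: simple_graph_def Delta_def)

end

theory Submission
  imports Defs
begin

text \<open>The hub \<open>V\<close> sees \<open>r + s + t\<close> consecutive colors. Let \<open>p\<close> and \<open>q\<close> be its neighbors along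
  the edges of least and greatest color. They are also joined by one of the hubs \<open>X\<close>, \<open>Y\<close>, \<open>Z\<close>,
  whose degree is at most \<open>s + t\<close>. Since \<open>p\<close> and \<open>q\<close> have degree 3, moving from \<open>V\<close> to that hub
  changes each of the two colors by at most 2, so \<open>r + s + t \<le> s + t + 4\<close>.\<close>

definition nbhd :: "'a ugraph \<Rightarrow> 'a \<Rightarrow> 'a set" where
  "nbhd G v = {w. {v, w} \<in> edges G}"

definition degree :: "'a ugraph \<Rightarrow> 'a \<Rightarrow> nat" where
  "degree G v = card (nbhd G v)"

lemma nbhd_sym: "w \<in> nbhd G v \<longleftrightarrow> v \<in> nbhd G w"
  by (simp add: nbhd_def insert_commute)

lemma nbhd_subset_verts:
  assumes "simple_graph G"
  shows "nbhd G v \<subseteq> verts G"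
  using assms by (auto simp: simple_graph_def nbhd_def)

lemma spectrum_eq_image_nbhd:
  assumes "simple_graph G"
  shows "spectrum G v \<alpha> = (\<lambda>w. \<alpha> {v, w}) ` nbhd G v"
proof -
  have "{e \<in> edges G. v \<in> e} = (\<lambda>w. {v, w}) ` nbhd G v"
  proof (intro equalityI subsetI)
    fix e assume e: "e \<in> {e \<in> edges G. v \<in> e}"
    then have "card e = 2" using assms by (auto simp: simple_graph_def)
    then obtain x y where "e = {x, y}" by (auto simp: card_2_iff)
    with e show "e \<in> (\<lambda>w. {v, w}) ` nbhd G v"
      by (auto simp: nbhd_def insert_commute)
  qed (auto simp: nbhd_def)
  then show ?thesis by (simp add: spectrum_def image_image)
qed

lemma inj_on_nbhd_if_proper_edge_coloring:
  assumes "proper_edge_coloring G \<alpha>"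
  shows "inj_on (\<lambda>w. \<alpha> {v, w}) (nbhd G v)"
proof (rule inj_onI, rule ccontr)
  fix x y assume xy: "x \<in> nbhd G v" "y \<in> nbhd G v" "\<alpha> {v, x} = \<alpha> {v, y}" "x \<noteq> y"
  then have "{v, x} \<noteq> {v, y}" by (simp add: doubleton_eq_iff)
  with xy assms show False by (auto simp: proper_edge_coloring_def nbhd_def)
qed

lemma card_spectrum:
  assumes "simple_graph G" and "proper_edge_coloring G \<alpha>"
  shows "card (spectrum G v \<alpha>) = degree G v"
  by (simp add: assms spectrum_eq_image_nbhd card_image inj_on_nbhd_if_proper_edge_coloring
      degree_def)

lemma interval_coloring_colors_at_vertex:
  assumes "simple_graph G" and "interval_coloring G t \<alpha>" and "v \<in> verts G"
  obtains m where "(\<lambda>w. \<alpha> {v, w}) ` nbhd G v = {m..<m + degree G v}"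
proof -
  obtain m n where interval: "spectrum G v \<alpha> = {m..n}"
    using assms(2,3) unfolding interval_coloring_def by blast
  have "proper_edge_coloring G \<alpha>"
    using assms(2) by (simp add: interval_coloring_def)
  then have "degree G v = Suc n - m"
    using card_spectrum[OF assms(1), of \<alpha> v] by (simp add: interval)
  then have "{m..n} = {m..<m + degree G v}" by auto
  with interval that show thesis
    by (simp add: spectrum_eq_image_nbhd[OF assms(1)])
qed

lemma interval_coloring_less_add_degree:
  assumes "simple_graph G" and "interval_coloring G t \<alpha>" and "v \<in> verts G"
    and "a \<in> nbhd G v" and "b \<in> nbhd G v"
  shows "\<alpha> {v, a} < \<alpha> {v, b} + degree G v"
proof -
  obtain m where "(\<lambda>w. \<alpha> {v, w}) ` nbhd G v = {m..<m + degree G v}"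
    using interval_coloring_colors_at_vertex[OF assms(1-3)] .
  then have "\<alpha> {v, a} \<in> {m..<m + degree G v}" "\<alpha> {v, b} \<in> {m..<m + degree G v}"
    using assms(4,5) by blast+
  then show ?thesis by simp
qed

lemma interval_coloring_extreme_neighbors:
  assumes "simple_graph G" and "interval_coloring G t \<alpha>" and "v \<in> verts G"
    and "degree G v > 0"
  obtains p q where "p \<in> nbhd G v" and "q \<in> nbhd G v"
    and "\<alpha> {v, p} + degree G v = Suc (\<alpha> {v, q})"
proof -
  obtain m where colors: "(\<lambda>w. \<alpha> {v, w}) ` nbhd G v = {m..<m + degree G v}"
    using interval_coloring_colors_at_vertex[OF assms(1-3)] .
  have "m \<in> {m..<m + degree G v}" "m + degree G v - 1 \<in> {m..<m + degree G v}"
    using assms(4) by auto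
  then obtain p q where "p \<in> nbhd G v" "\<alpha> {v, p} = m"
    and "q \<in> nbhd G v" "\<alpha> {v, q} = m + degree G v - 1"
    unfolding colors[symmetric] by auto
  with that show thesis using assms(4) by simp
qed

lemma degree_le_if_neighbors_joined:
  assumes simple: "simple_graph G" and col: "interval_coloring G t \<alpha>" and v: "v \<in> verts G"
    and neighbor: "\<And>p. p \<in> nbhd G v \<Longrightarrow> degree G p \<le> Suc k"
    and hub: "\<And>p q. p \<in> nbhd G v \<Longrightarrow> q \<in> nbhd G v \<Longrightarrow>
      \<exists>h. p \<in> nbhd G h \<and> q \<in> nbhd G h \<and> degree G h \<le> d"
  shows "degree G v \<le> d + 2 * k"
proof (cases "degree G v = 0")
  case False
  then obtain p q where p: "p \<in> nbhd G v" and q: "q \<in> nbhd G v"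
    and extreme: "\<alpha> {v, p} + degree G v = Suc (\<alpha> {v, q})"
    using interval_coloring_extreme_neighbors[OF simple col v] by blast
  obtain h where h: "p \<in> nbhd G h" "q \<in> nbhd G h" "degree G h \<le> d"
    using hub p q by blast
  have color_change: "\<alpha> {a, w} \<le> \<alpha> {b, w} + k"
    if "w \<in> nbhd G v" "w \<in> nbhd G a" "w \<in> nbhd G b" for w a b
  proof -
    have "w \<in> verts G" using that(1) nbhd_subset_verts[OF simple] by blast
    then have "\<alpha> {w, a} < \<alpha> {w, b} + degree G w"
      using interval_coloring_less_add_degree[OF simple col] that(2,3) by (simp add: nbhd_sym)
    then show ?thesis using neighbor[OF that(1)] by (simp add: insert_commute)
  qed
  have "h \<in> verts G" using h(1) nbhd_subset_verts[OF simple] nbhd_sym[of p G h] by blast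
  then have "\<alpha> {h, q} < \<alpha> {h, p} + d"
    using interval_coloring_less_add_degree[OF simple col _ h(2,1)] h(3) by fastforce
  moreover have "\<alpha> {h, p} \<le> \<alpha> {v, p} + k" using color_change p h(1) by blast
  moreover have "\<alpha> {v, q} \<le> \<alpha> {h, q} + k" using color_change q h(2) by blast
  ultimately show ?thesis using extreme by linarith
qed simp

lemma nbhd_Delta_hubs:
  "nbhd (Delta r s t) V = A ` {1..r} \<union> B ` {1..s} \<union> C ` {1..t}"
  "nbhd (Delta r s t) X = A ` {1..r} \<union> B ` {1..s}"
  "nbhd (Delta r s t) Y = A ` {1..r} \<union> C ` {1..t}"
  "nbhd (Delta r s t) Z = B ` {1..s} \<union> C ` {1..t}"
  by (auto simp: nbhd_def Delta_def doubleton_eq_iff)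

lemma degree_Delta_hubs:
  "degree (Delta r s t) V = r + s + t"
  "degree (Delta r s t) X = r + s"
  "degree (Delta r s t) Y = r + t"
  "degree (Delta r s t) Z = s + t"
  unfolding degree_def nbhd_Delta_hubs
  by (subst card_Un_disjoint | force simp: card_image inj_on_def)+

lemma degree_Delta_le_3_if_nbhd_V:
  assumes "p \<in> nbhd (Delta r s t) V"
  shows "degree (Delta r s t) p \<le> 3"
proof -
  have "nbhd (Delta r s t) (A i) \<subseteq> {V, X, Y}" "nbhd (Delta r s t) (B i) \<subseteq> {V, X, Z}"
    "nbhd (Delta r s t) (C i) \<subseteq> {V, Y, Z}" for i
    by (auto simp: nbhd_def Delta_def doubleton_eq_iff)
  with assms obtain a b c where "nbhd (Delta r s t) p \<subseteq> {a, b, c}"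
    unfolding nbhd_Delta_hubs by blast
  then have "degree (Delta r s t) p \<le> card {a, b, c}"
    by (simp add: degree_def card_mono)
  also have "\<dots> \<le> 3" by (simp add: card_insert_if)
  finally show ?thesis .
qed

lemma nbhd_Delta_V_joined:
  assumes "p \<in> nbhd (Delta r s t) V" and "q \<in> nbhd (Delta r s t) V"
  shows "\<exists>h\<in>{X, Y, Z}. p \<in> nbhd (Delta r s t) h \<and> q \<in> nbhd (Delta r s t) h"
  using assms by (auto simp: nbhd_Delta_hubs)

theorem theorem6:
  fixes r s t :: nat
  assumes "1 \<le> r" and "r \<le> s" and "s \<le> t" and "5 \<le> r"
  shows "Delta r s t \<notin> \<NN>"
proof
  let ?G = "Delta r s t"
  assume "?G \<in> \<NN>"
  then obtain k \<alpha> where col: "interval_coloring ?G k \<alpha>"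
    by (auto simp: interval_colorable_def)
  have "degree ?G V \<le> (s + t) + 2 * 2"
  proof (rule degree_le_if_neighbors_joined[OF simple_graph_Delta col])
    show "V \<in> verts ?G" by (simp add: Delta_def)
    show "degree ?G p \<le> Suc 2" if "p \<in> nbhd ?G V" for p
      using degree_Delta_le_3_if_nbhd_V[OF that] by simp
    have "degree ?G h \<le> s + t" if "h \<in> {X, Y, Z}" for h
      using that assms by (auto simp: degree_Delta_hubs)
    then show "\<exists>h. p \<in> nbhd ?G h \<and> q \<in> nbhd ?G h \<and> degree ?G h \<le> s + t"
      if "p \<in> nbhd ?G V" "q \<in> nbhd ?G V" for p q
      using nbhd_Delta_V_joined[OF that] by blast
  qed
  then show False using assms by (simp add: degree_Delta_hubs)
qed

end
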